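(* Let $\pi=UUD$ and, for $k\geqslant 0$, let $A_k(x)$ be the generating function, by semilength, of the Dyck paths $P\in\mathcal{D}^{h_\pi,\geqslant}$ with $h_\pi(P)=k$. Then the amplitude of $\pi$ is $r_\pi=2$, and $$A_2(x)=\frac{x^2}{(x-1)(x^2+x-1)},\qquad A_1(x)=0,\qquad A_0(x)=\frac{1}{1-x}.$$
   Context: A Dyck path is a lattice path starting at $(0,0)$, ending on the $x$-axis, never going below it, with steps $U=(1,1)$ and $D=(1,-1)$. A pattern is a factor of consecutive steps; the height of an occurrence is the maximal ordinate reached by its points; $h_\pi(P)$ is the maximal height of an occurrence of $\pi$ in $P$ ($0$ if $\pi$ does not occur). The amplitude $r_\pi$ is the height of $\pi$ viewed as a path in the quarter plane whose lowest point touches the $x$-axis. The set $\mathcal{D}^{h_\pi,\geqslant}$ consists of the empty path together with all Dyck paths $P$ whose first return decomposition $P=U\alpha D\beta$ satisfies $\alpha,\beta\in\mathcal{D}^{h_\pi,\geqslant}$ and $h_\pi(U\alpha D)\geqslant h_\pi(\beta)$ (with $h_\pi(U\alpha D)$ computed on the path $U\alpha D$ alone). *)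

theory Defs
  imports "HOL-Computational_Algebra.Formal_Power_Series"
begin

datatype step = U | D

fun rise :: "step \<Rightarrow> int" where
  "rise U = 1"
| "rise D = -1"

text \<open>The ordinates of all points of a path (both endpoints included) that starts at ordinate \<open>a\<close>.\<close>

fun ordinates :: "int \<Rightarrow> step list \<Rightarrow> int list" where
  "ordinates a [] = [a]"
| "ordinates a (s # p) = a # ordinates (a + rise s) p"

definition dyck_path :: "step list \<Rightarrow> bool" where
  "dyck_path P \<longleftrightarrow> (\<forall>y \<in> set (ordinates 0 P). 0 \<le> y) \<and> last (ordinates 0 P) = 0"

definition semilength :: "step list \<Rightarrow> nat" where
  "semilength P = length P div 2"

definition occurrence_heights :: "step list \<Rightarrow> step list \<Rightarrow> int set" where
  "occurrence_heights \<pi> P =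
     {Max (set (ordinates (last (ordinates 0 xs)) \<pi>)) | xs ys. P = xs @ \<pi> @ ys}"

definition pattern_height :: "step list \<Rightarrow> step list \<Rightarrow> int" where
  "pattern_height \<pi> P =
     (if occurrence_heights \<pi> P = {} then 0 else Max (occurrence_heights \<pi> P))"

text \<open>Starting \<open>\<pi>\<close> at minus its minimal relative ordinate puts its lowest point on the x-axis.\<close>

definition amplitude :: "step list \<Rightarrow> int" where
  "amplitude \<pi> = Max (set (ordinates (- Min (set (ordinates 0 \<pi>))) \<pi>))"

text \<open>As \<open>\<alpha>\<close> is itself a Dyck path, the displayed \<open>D\<close> is the first return to the x-axis.\<close>

definition first_return_decomp :: "step list \<Rightarrow> step list \<Rightarrow> step list \<Rightarrow> bool" where
  "first_return_decomp P \<alpha> \<beta> \<longleftrightarrow> dyck_path \<alpha> \<and> dyck_path \<beta> \<and> P = [U] @ \<alpha> @ [D] @ \<beta>"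

inductive_set dyck_geq :: "step list \<Rightarrow> step list set" for \<pi> :: "step list" where
  empty: "[] \<in> dyck_geq \<pi>"
| decomp: "\<lbrakk>dyck_path P; first_return_decomp P \<alpha> \<beta>; \<alpha> \<in> dyck_geq \<pi>; \<beta> \<in> dyck_geq \<pi>;
     pattern_height \<pi> ([U] @ \<alpha> @ [D]) \<ge> pattern_height \<pi> \<beta>\<rbrakk> \<Longrightarrow> P \<in> dyck_geq \<pi>"

definition height_gf :: "step list \<Rightarrow> nat \<Rightarrow> rat fps" where
  "height_gf \<pi> k = Abs_fps (\<lambda>n. of_nat
     (card {P \<in> dyck_geq \<pi>. pattern_height \<pi> P = int k \<and> semilength P = n}))"

end

theory Submission imports Defs begin

text \<open>No occurrence of UUD straddles the factors \<open>U\<alpha>D\<close> and \<open>\<beta>\<close> of the first return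
  decomposition, so membership in the class forces \<open>h(U\<alpha>D\<beta>) = h(U\<alpha>D)\<close>.
  Every occurrence of UUD in \<open>\<alpha>\<close> has height at least 2 and is lifted by one inside
  \<open>U\<alpha>D\<close>; hence \<open>h(U\<alpha>D) = 2\<close> exactly when \<open>\<alpha>\<close> is nonempty and avoids UUD, that is
  \<open>\<alpha> = (UD)\<^sup>k\<close> with \<open>k \<ge> 1\<close>. As the only UUD-avoiding paths are the \<open>(UD)\<^sup>n\<close>, this gives
  \<open>A\<^sub>0 = 1/(1-x)\<close> and \<open>A\<^sub>2 = x\<^sup>2/(1-x) (A\<^sub>0 + A\<^sub>2)\<close>.\<close>

section \<open>Net rise and ordinates of Dyck paths\<close>

abbreviation net_rise :: "step list \<Rightarrow> int" where
  "net_rise xs \<equiv> sum_list (map rise xs)"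

lemma ordinates_not_Nil [simp]: "ordinates a xs \<noteq> []"
  by (cases xs) auto

lemma last_ordinates: "last (ordinates a xs) = a + net_rise xs"
  by (induction xs arbitrary: a) auto

lemma set_ordinates_append:
  "set (ordinates a (xs @ ys)) = set (ordinates a xs) \<union> set (ordinates (a + net_rise xs) ys)"
proof (induction xs arbitrary: a)
  case Nil
  then show ?case by (cases ys) auto
qed (auto simp: add.assoc)

lemma set_ordinates_shift: "set (ordinates (a + b) xs) = (+) a ` set (ordinates b xs)"
  by (induction xs arbitrary: b) (auto simp: add.assoc)

lemma dyck_path_Nil: "dyck_path []"
  by (simp add: dyck_path_def)

lemma net_rise_dyck_path: "dyck_path P \<Longrightarrow> net_rise P = 0"
  by (simp add: dyck_path_def last_ordinates)

text \<open>The net rise of a prefix is the ordinate of the point where it ends, which is a point of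
  the whole path.\<close>

lemma net_rise_prefix_nonneg:
  assumes "dyck_path (xs @ ys)"
  shows "net_rise xs \<ge> 0"
proof -
  have "last (ordinates 0 xs) \<in> set (ordinates 0 xs)"
    by (rule last_in_set) simp
  then show ?thesis
    using assms by (auto simp: dyck_path_def set_ordinates_append last_ordinates)
qed

lemma dyck_path_compose:
  assumes "dyck_path \<alpha>" "dyck_path \<beta>"
  shows "dyck_path (U # \<alpha> @ D # \<beta>)"
proof -
  have "set (ordinates 1 \<alpha>) = (+) 1 ` set (ordinates 0 \<alpha>)"
    using set_ordinates_shift[of 1 0 \<alpha>] by simp
  then show ?thesis
    using assms net_rise_dyck_path[OF assms(1)] net_rise_dyck_path[OF assms(2)]
    by (auto simp: dyck_path_def set_ordinates_append last_ordinates)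
qed

section \<open>Occurrences of UUD and their heights\<close>

abbreviation occ :: "step list \<Rightarrow> int set" where
  "occ \<equiv> occurrence_heights [U, U, D]"

abbreviation ph :: "step list \<Rightarrow> int" where
  "ph \<equiv> pattern_height [U, U, D]"

lemma occ_eq: "occ P = {net_rise xs + 2 | xs ys. P = xs @ [U, U, D] @ ys}"
proof -
  have "Max (set (ordinates a [U, U, D])) = a + 2" for a
    by simp
  then show ?thesis
    by (simp add: occurrence_heights_def last_ordinates add.commute)
qed

text \<open>An occurrence is determined by the length of the prefix before it. Finiteness makes the
  \<open>Max\<close> in \<open>pattern_height\<close> meaningful.\<close>

lemma finite_occ: "finite (occ P)"
proof (rule finite_subset)
  show "occ P \<subseteq> (\<lambda>n. net_rise (take n P) + 2) ` {..length P}"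
  proof
    fix h assume "h \<in> occ P"
    then obtain xs ys where "P = xs @ [U, U, D] @ ys" "h = net_rise xs + 2"
      by (auto simp: occ_eq)
    then show "h \<in> (\<lambda>n. net_rise (take n P) + 2) ` {..length P}"
      by (intro image_eqI[of _ _ "length xs"]) auto
  qed
qed simp

lemma occ_ge_2: "dyck_path P \<Longrightarrow> h \<in> occ P \<Longrightarrow> h \<ge> 2"
  by (auto simp: occ_eq dest: net_rise_prefix_nonneg)

lemma ph_ge_occ: "h \<in> occ P \<Longrightarrow> h \<le> ph P"
  using finite_occ by (auto simp: pattern_height_def)

lemma ph_in_occ: "occ P \<noteq> {} \<Longrightarrow> ph P \<in> occ P"
  using finite_occ by (auto simp: pattern_height_def)

text \<open>The default value 0 is unambiguous on Dyck paths, since a genuine occurrence there has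
  height at least 2.\<close>

lemma ph_eq_0_iff: "dyck_path P \<Longrightarrow> ph P = 0 \<longleftrightarrow> occ P = {}"
  using ph_in_occ[of P] occ_ge_2[of P] by (force simp: pattern_height_def)

lemma ph_cases: "dyck_path P \<Longrightarrow> ph P = 0 \<or> ph P \<ge> 2"
  using ph_in_occ[of P] occ_ge_2[of P] ph_eq_0_iff[of P] by blast

lemma occ_U_D: "occ [U, D] = {}"
  by (auto simp: occ_eq Cons_eq_append_conv)

lemma occ_Nil: "occ [] = {}"
  by (auto simp: occ_eq)

text \<open>A straddling occurrence would have the displayed D as its first or second step, but both
  of these are U. The zero net rise keeps heights in \<beta> unchanged.\<close>

lemma occ_append_D:
  assumes "net_rise (xs @ [D]) = 0"
  shows "occ (xs @ D # \<beta>) = occ (xs @ [D]) \<union> occ \<beta>"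
proof (intro equalityI subsetI)
  fix h assume "h \<in> occ (xs @ D # \<beta>)"
  then obtain us vs where eq: "(xs @ [D]) @ \<beta> = us @ U # U # D # vs" and h: "h = net_rise us + 2"
    by (auto simp: occ_eq)
  from eq obtain ws where "xs @ [D] = us @ ws \<and> ws @ \<beta> = U # U # D # vs
      \<or> (xs @ [D]) @ ws = us \<and> \<beta> = ws @ U # U # D # vs"
    unfolding append_eq_append_conv2 by blast
  \<comment> \<open>An occurrence starting exactly at the junction has \<open>ws = []\<close> and is
    put in the first case.\<close>
  then consider "us = (xs @ [D]) @ ws" "\<beta> = ws @ U # U # D # vs"
    | "xs @ [D] = us @ ws" "ws @ \<beta> = U # U # D # vs" "ws \<noteq> []"
    by (cases "ws = []") auto
  then show "h \<in> occ (xs @ [D]) \<union> occ \<beta>"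
  proof cases
    case 1
    then have "\<beta> = ws @ [U, U, D] @ vs" "h = net_rise ws + 2"
      using h assms by auto
    then show ?thesis
      unfolding occ_eq by blast
  next
    case 2
    \<comment> \<open>A nonempty \<open>ws\<close> ends in D, so it cannot be just the first one or
      two steps of UUD.\<close>
    have "last ws = D"
      using 2 by (metis last_appendR last_snoc)
    then obtain zs where "ws = U # U # D # zs"
      using 2 by (auto simp: append_eq_Cons_conv)
    then have "xs @ [D] = us @ [U, U, D] @ zs"
      using 2 by simp
    then show ?thesis
      using h unfolding occ_eq by blast
  qed
next
  fix h assume "h \<in> occ (xs @ [D]) \<union> occ \<beta>"
  then show "h \<in> occ (xs @ D # \<beta>)"
  proof
    assume "h \<in> occ (xs @ [D])"
    then obtain us vs where eq: "xs @ [D] = us @ U # U # D # vs" and h: "h = net_rise us + 2"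
      by (auto simp: occ_eq)
    have "xs @ D # \<beta> = us @ [U, U, D] @ (vs @ \<beta>)"
      using arg_cong[OF eq, of "\<lambda>zs. zs @ \<beta>"] by simp
    with h show ?thesis
      unfolding occ_eq by blast
  next
    assume "h \<in> occ \<beta>"
    then obtain us vs where "\<beta> = us @ U # U # D # vs" "h = net_rise us + 2"
      by (auto simp: occ_eq)
    then have "xs @ D # \<beta> = (xs @ [D] @ us) @ [U, U, D] @ vs" "h = net_rise (xs @ [D] @ us) + 2"
      using assms by auto
    then show ?thesis
      unfolding occ_eq by blast
  qed
qed

text \<open>The new initial U creates an occurrence exactly when \<alpha> begins with UD. The final
  D creates none, because a Dyck path neither ends in UU nor equals U.\<close>

lemma occ_elevate:
  assumes "dyck_path \<alpha>"
  shows "occ (U # \<alpha> @ [D]) = (if \<exists>ys. \<alpha> = U # D # ys then {2} else {}) \<union> (+) 1 ` occ \<alpha>"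
proof (intro equalityI subsetI)
  fix h assume "h \<in> occ (U # \<alpha> @ [D])"
  then obtain us vs where eq: "U # \<alpha> @ [D] = us @ U # U # D # vs" and h: "h = net_rise us + 2"
    by (auto simp: occ_eq)
  show "h \<in> (if \<exists>ys. \<alpha> = U # D # ys then {2} else {}) \<union> (+) 1 ` occ \<alpha>"
  proof (cases us)
    case Nil
    with eq have *: "\<alpha> @ [D] = U # D # vs" by simp
    have "\<alpha> \<noteq> [U]"
      using net_rise_dyck_path[OF assms] by auto
    with * have "\<exists>ys. \<alpha> = U # D # ys"
      by (auto simp: append_eq_Cons_conv)
    then show ?thesis
      using Nil h by auto
  next
    case (Cons s ws)
    with eq have s: "s = U" and *: "\<alpha> @ [D] = ws @ U # U # D # vs" by auto
    \<comment> \<open>Otherwise the occurrence uses the final D, so \<alpha> ends in UU and the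
      prefix \<open>ws\<close> would end at ordinate -2.\<close>
    have "vs \<noteq> []"
    proof
      assume "vs = []"
      with * have "\<alpha> = ws @ [U, U]" by simp
      then show False
        using net_rise_dyck_path[OF assms] net_rise_prefix_nonneg[of ws "[U, U]"] assms by simp
    qed
    then obtain vs' v where "vs = vs' @ [v]"
      by (metis rev_exhaust)
    with * have "\<alpha> = ws @ [U, U, D] @ vs'" by simp
    then have "net_rise ws + 2 \<in> occ \<alpha>"
      unfolding occ_eq by blast
    moreover have "h = 1 + (net_rise ws + 2)"
      using h Cons s by simp
    ultimately show ?thesis by blast
  qed
next
  fix h assume "h \<in> (if \<exists>ys. \<alpha> = U # D # ys then {2} else {}) \<union> (+) 1 ` occ \<alpha>"
  then consider ys where "\<alpha> = U # D # ys" "h = 2" | g where "g \<in> occ \<alpha>" "h = 1 + g"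
    by (auto split: if_splits)
  then show "h \<in> occ (U # \<alpha> @ [D])"
  proof cases
    case 1
    then have "U # \<alpha> @ [D] = [] @ [U, U, D] @ (ys @ [D])" "h = net_rise [] + 2"
      by auto
    then show ?thesis
      unfolding occ_eq by blast
  next
    case 2
    then obtain us vs where "\<alpha> = us @ [U, U, D] @ vs" "g = net_rise us + 2"
      by (auto simp: occ_eq)
    then have "U # \<alpha> @ [D] = (U # us) @ [U, U, D] @ (vs @ [D])" "h = net_rise (U # us) + 2"
      using 2 by auto
    then show ?thesis
      unfolding occ_eq by blast
  qed
qed

lemma occ_compose:
  assumes "dyck_path \<alpha>"
  shows "occ (U # \<alpha> @ D # \<beta>) = occ (U # \<alpha> @ [D]) \<union> occ \<beta>"
  using occ_append_D[of "U # \<alpha>" \<beta>] net_rise_dyck_path[OF assms] by simp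

section \<open>The UUD-avoiding paths\<close>

fun zigzag :: "nat \<Rightarrow> step list" where
  "zigzag 0 = []"
| "zigzag (Suc n) = U # D # zigzag n"

lemma length_zigzag [simp]: "length (zigzag n) = 2 * n"
  by (induction n) auto

lemma dyck_path_zigzag: "dyck_path (zigzag n)"
  using dyck_path_compose[OF dyck_path_Nil] by (induction n) (auto simp: dyck_path_Nil)

lemma occ_zigzag: "occ (zigzag n) = {}"
proof (induction n)
  case (Suc n)
  then show ?case
    using occ_compose[OF dyck_path_Nil, of "zigzag n"] by (simp add: occ_U_D)
qed (simp add: occ_Nil)

lemma ph_zigzag: "ph (zigzag n) = 0"
  by (simp add: pattern_height_def occ_zigzag)

text \<open>The D after the zigzag stands where a further block would start with U, so it marks the
  end of the zigzag. This makes the later decomposition unique.\<close>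

lemma zigzag_append_D_inject:
  "zigzag i @ D # \<beta> = zigzag j @ D # \<gamma> \<longleftrightarrow> i = j \<and> \<beta> = \<gamma>"
proof (induction i arbitrary: j)
  case 0
  then show ?case by (cases j) auto
next
  case (Suc i)
  then show ?case by (cases j) auto
qed

section \<open>Members of the class of height 0 and 2\<close>

abbreviation cls :: "step list set" where
  "cls \<equiv> dyck_geq [U, U, D]"

lemma dyck_path_cls: "P \<in> cls \<Longrightarrow> dyck_path P"
  by (erule dyck_geq.cases) (auto simp: dyck_path_Nil)

lemma cls_compose:
  assumes "\<alpha> \<in> cls" "\<beta> \<in> cls" "ph \<beta> \<le> ph (U # \<alpha> @ [D])"
  shows "U # \<alpha> @ D # \<beta> \<in> cls"
  by (rule dyck_geq.decomp[of _ \<alpha> \<beta>])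
    (use assms dyck_path_cls dyck_path_compose in \<open>auto simp: first_return_decomp_def\<close>)

lemma zigzag_in_cls: "zigzag n \<in> cls"
proof (induction n)
  case (Suc n)
  then show ?case
    using cls_compose[of "[]" "zigzag n"]
    by (simp add: dyck_geq.empty ph_zigzag pattern_height_def[of _ "[U, D]"] occ_U_D)
qed (simp add: dyck_geq.empty)

text \<open>By induction \<alpha> and \<beta> are zigzags. A nonempty zigzag \<alpha> begins with
  UD, which would give an occurrence in U\<alpha>D, so \<alpha> is empty.\<close>

lemma cls_occ_empty: "P \<in> cls \<Longrightarrow> occ P = {} \<Longrightarrow> \<exists>n. P = zigzag n"
proof (induction rule: dyck_geq.induct)
  case empty
  then show ?case by (metis zigzag.simps(1))
next
  case (decomp P \<alpha> \<beta>)
  then have P: "P = U # \<alpha> @ D # \<beta>" and \<alpha>: "dyck_path \<alpha>"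
    by (auto simp: first_return_decomp_def)
  have 1: "occ (U # \<alpha> @ [D]) = {}" and 2: "occ \<beta> = {}"
    using decomp.prems unfolding P occ_compose[OF \<alpha>, of \<beta>] by simp_all
  from 1 have "occ \<alpha> = {}" and ne: "\<nexists>ys. \<alpha> = U # D # ys"
    using occ_elevate[OF \<alpha>] by (auto split: if_splits)
  then obtain i where "\<alpha> = zigzag i"
    using decomp.IH by blast
  with ne have "\<alpha> = []"
    by (cases i) auto
  moreover obtain j where "\<beta> = zigzag j"
    using decomp.IH 2 by blast
  ultimately have "P = zigzag (Suc j)"
    using P by simp
  then show ?case ..
qed

lemma cls_ph_eq_0_iff: "P \<in> cls \<and> ph P = 0 \<longleftrightarrow> (\<exists>n. P = zigzag n)"
  using cls_occ_empty[of P] ph_eq_0_iff[OF dyck_path_cls[of P]] zigzag_in_cls ph_zigzag by blast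

lemma occ_elevate_zigzag: "occ (U # zigzag (Suc k) @ [D]) = {2}"
  using occ_elevate[OF dyck_path_zigzag, of "Suc k"] occ_zigzag[of "Suc k"] by simp

text \<open>Combinatorial form of the equation for the height 2 series: \<open>Suc k\<close> makes
  \<alpha> nonempty, and the disjunction is \<open>ph \<beta> \<le> 2\<close>, as height 1 is
  impossible.\<close>

lemma cls_ph_eq_2_iff:
  "P \<in> cls \<and> ph P = 2 \<longleftrightarrow>
     (\<exists>k \<beta>. P = U # zigzag (Suc k) @ D # \<beta> \<and> \<beta> \<in> cls \<and> (ph \<beta> = 0 \<or> ph \<beta> = 2))"
  (is "?L \<longleftrightarrow> ?R")
proof
  assume ?L
  then have "P \<in> cls" and h: "ph P = 2" by auto
  from this(1) show ?R
  proof cases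
    case empty
    then show ?thesis
      using h by (simp add: pattern_height_def occ_Nil)
  next
    case (decomp \<alpha> \<beta>)
    then have P: "P = U # \<alpha> @ D # \<beta>" and \<alpha>: "dyck_path \<alpha>" and \<beta>: "dyck_path \<beta>"
      and le: "ph \<beta> \<le> ph (U # \<alpha> @ [D])"
      by (auto simp: first_return_decomp_def)
    have occ_P: "occ P = occ (U # \<alpha> @ [D]) \<union> occ \<beta>"
      unfolding P by (rule occ_compose[OF \<alpha>])
    \<comment> \<open>An occurrence in \<alpha> is lifted to height at least 3 in
      \<open>P\<close>.\<close>
    have "occ \<alpha> = {}"
    proof (rule ccontr)
      assume "occ \<alpha> \<noteq> {}"
      then obtain g where g: "g \<in> occ \<alpha>" by auto
      then have "1 + g \<in> occ P"
        using occ_P occ_elevate[OF \<alpha>] by auto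
      then show False
        using ph_ge_occ[of "1 + g" P] h occ_ge_2[OF \<alpha> g] by simp
    qed
    then obtain i where i: "\<alpha> = zigzag i"
      using cls_occ_empty decomp by blast
    \<comment> \<open>For empty \<alpha> the factor UD has height 0, so the class condition forces
      \<open>ph \<beta> \<le> 0\<close>, although \<beta> would carry all occurrences of
      \<open>P\<close>.\<close>
    have "i \<noteq> 0"
    proof
      assume "i = 0"
      then have "occ (U # \<alpha> @ [D]) = {}"
        using i occ_U_D by simp
      then have "ph \<beta> \<le> 0" and "occ P = occ \<beta>"
        using le occ_P by (auto simp: pattern_height_def[of _ "U # \<alpha> @ [D]"])
      then show False
        using h by (simp add: pattern_height_def split: if_splits)
    qed
    then obtain k where k: "\<alpha> = zigzag (Suc k)"
      using i by (metis not0_implies_Suc)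
    have "ph \<beta> \<le> 2"
      using le occ_elevate_zigzag[of k] k by (simp add: pattern_height_def[of _ "U # _"])
    then have "ph \<beta> = 0 \<or> ph \<beta> = 2"
      using ph_cases[OF \<beta>] by linarith
    with P k decomp show ?thesis by blast
  qed
next
  assume ?R
  then obtain k \<beta> where P: "P = U # zigzag (Suc k) @ D # \<beta>" and \<beta>: "\<beta> \<in> cls"
    and h: "ph \<beta> = 0 \<or> ph \<beta> = 2" by blast
  have ph2: "ph (U # zigzag (Suc k) @ [D]) = 2"
    unfolding pattern_height_def occ_elevate_zigzag by simp
  have "P \<in> cls"
    unfolding P using h ph2 by (intro cls_compose zigzag_in_cls \<beta>) auto
  moreover have "occ P = {2}"
  proof -
    have "occ \<beta> \<subseteq> {2}"
      using h ph_ge_occ[of _ \<beta>] occ_ge_2[OF dyck_path_cls[OF \<beta>]] by force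
    then show ?thesis
      unfolding P occ_compose[OF dyck_path_zigzag, of _ \<beta>] occ_elevate_zigzag by auto
  qed
  ultimately show ?L
    by (simp add: pattern_height_def)
qed

section \<open>Counting by semilength\<close>

abbreviation level :: "nat \<Rightarrow> nat \<Rightarrow> step list set" where
  "level k n \<equiv> {P \<in> cls. ph P = int k \<and> semilength P = n}"

lemma finite_semilength: "finite {P. semilength P = n}"
proof (rule finite_subset)
  have "s \<in> {U, D}" for s
    by (cases s) auto
  then show "{P. semilength P = n} \<subseteq> {P. set P \<subseteq> {U, D} \<and> length P \<le> 2 * n + 1}"
    by (auto simp: semilength_def)
  show "finite {P. set P \<subseteq> {U, D} \<and> length P \<le> 2 * n + 1}"
    by (rule finite_lists_length_le) simp
qed

lemma finite_level: "finite (level k n)"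
  by (rule finite_subset[OF _ finite_semilength[of n]]) auto

lemma level_0: "level 0 n = {zigzag n}"
proof -
  have "P \<in> level 0 n \<longleftrightarrow> P = zigzag n" for P
    using cls_ph_eq_0_iff[of P] by (auto simp: semilength_def)
  then show ?thesis by blast
qed

lemma level_1: "level 1 n = {}"
  using ph_cases dyck_path_cls by fastforce

lemma semilength_compose:
  "semilength (U # zigzag k @ D # \<beta>) = Suc k + semilength \<beta>"
  by (simp add: semilength_def)

text \<open>Here \<open>i\<close> is the semilength of the factor U\<alpha>D, so
  \<open>i \<ge> 2\<close> says that \<alpha> is nonempty. This indexing turns the count into a
  convolution.\<close>

lemma level_2:
  "level 2 n = (\<lambda>(i, \<beta>). U # zigzag (i - 1) @ D # \<beta>) `
     (SIGMA i:{2..n}. level 0 (n - i) \<union> level 2 (n - i))" (is "_ = ?f ` ?S")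
proof (intro equalityI subsetI)
  fix P assume P: "P \<in> level 2 n"
  then obtain k \<beta> where eq: "P = U # zigzag (Suc k) @ D # \<beta>" and \<beta>: "\<beta> \<in> cls"
    and h: "ph \<beta> = 0 \<or> ph \<beta> = 2"
    using cls_ph_eq_2_iff[of P] by auto
  have n: "n = Suc (Suc k) + semilength \<beta>"
    using P semilength_compose[of "Suc k" \<beta>] unfolding eq by auto
  have "(Suc (Suc k), \<beta>) \<in> ?S"
    using n \<beta> h by auto
  moreover have "P = ?f (Suc (Suc k), \<beta>)"
    using eq by simp
  ultimately show "P \<in> ?f ` ?S" by blast
next
  fix P assume "P \<in> ?f ` ?S"
  then obtain i \<beta> where i: "2 \<le> i" "i \<le> n" and \<beta>: "\<beta> \<in> cls" "ph \<beta> = 0 \<or> ph \<beta> = 2"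
    and s: "semilength \<beta> = n - i" and eq: "P = U # zigzag (i - 1) @ D # \<beta>"
    by auto
  obtain k where k: "i = Suc (Suc k)"
    using i by (metis add_2_eq_Suc le_Suc_ex)
  have "P \<in> cls \<and> ph P = 2"
    using cls_ph_eq_2_iff[of P] eq k \<beta> by auto
  moreover have "semilength P = n"
    using semilength_compose[of "i - 1" \<beta>] i s eq by simp
  ultimately show "P \<in> level 2 n" by simp
qed

lemma card_level_2: "card (level 2 n) = (\<Sum>i\<in>{2..n}. 1 + card (level 2 (n - i)))"
proof -
  have "inj_on (\<lambda>(i, \<beta>). U # zigzag (i - 1) @ D # \<beta>)
          (SIGMA i:{2..n}. level 0 (n - i) \<union> level 2 (n - i))"
    by (rule inj_onI) (auto simp: zigzag_append_D_inject)
  then have "card (level 2 n) = card (SIGMA i:{2..n}. level 0 (n - i) \<union> level 2 (n - i))"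
    unfolding level_2[of n] by (rule card_image)
  also have "\<dots> = (\<Sum>i\<in>{2..n}. card (level 0 (n - i) \<union> level 2 (n - i)))"
    by (intro card_SigmaI ballI finite_UnI finite_level) simp
  also have "\<dots> = (\<Sum>i\<in>{2..n}. 1 + card (level 2 (n - i)))"
  proof (rule sum.cong[OF refl])
    fix i
    have "level 0 (n - i) \<inter> level 2 (n - i) = {}" by auto
    then have "card (level 0 (n - i) \<union> level 2 (n - i)) =
        card (level 0 (n - i)) + card (level 2 (n - i))"
      by (intro card_Un_disjoint finite_level)
    \<comment> \<open>The summand 1 counts the single zigzag of semilength
      \<open>n - i\<close>.\<close>
    then show "card (level 0 (n - i) \<union> level 2 (n - i)) = 1 + card (level 2 (n - i))"
      unfolding level_0 by simp
  qed
  finally show ?thesis .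
qed

section \<open>Generating functions\<close>

lemma height_gf_nth: "fps_nth (height_gf [U, U, D] k) n = of_nat (card (level k n))"
  by (simp add: height_gf_def)

lemma geometric_fps: "Abs_fps (\<lambda>n. 1) * (1 - fps_X) = (1 :: rat fps)"
  by (simp add: fps_eq_iff algebra_simps)

lemma height_gf_0_eq_geometric: "height_gf [U, U, D] 0 = Abs_fps (\<lambda>n. 1)"
  by (rule fps_ext) (simp only: height_gf_nth level_0, simp)

lemma height_gf_0: "height_gf [U, U, D] 0 = 1 / (1 - fps_X)"
proof -
  have "1 - fps_X \<noteq> (0 :: rat fps)"
    using geometric_fps by auto
  then show ?thesis
    by (metis geometric_fps height_gf_0_eq_geometric nonzero_mult_div_cancel_right)
qed

lemma height_gf_1: "height_gf [U, U, D] 1 = 0"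
proof (rule fps_ext)
  show "fps_nth (height_gf [U, U, D] 1) n = fps_nth 0 n" for n
    unfolding height_gf_nth level_1 by simp
qed

lemma height_gf_2_functional_equation:
  "height_gf [U, U, D] 2 =
     fps_X ^ 2 * Abs_fps (\<lambda>n. 1) * (Abs_fps (\<lambda>n. 1) + height_gf [U, U, D] 2)"
  (is "?A = fps_X ^ 2 * ?G * _")
proof (rule fps_ext)
  fix n
  \<comment> \<open>The series \<open>fps_X ^ 2 * ?G\<close> has coefficient 0 below index 2 and 1
    from there on, which yields the range \<open>{2..n}\<close>.\<close>
  have "fps_nth (fps_X ^ 2 * ?G * (?G + ?A)) n =
      (\<Sum>i=0..n. (if i < 2 then 0 else 1) * (1 + fps_nth ?A (n - i)))"
    unfolding fps_mult_nth[of "fps_X ^ 2 * ?G"] by (simp add: fps_X_power_mult_nth cong: if_cong)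
  also have "\<dots> = (\<Sum>i\<in>{2..n}. 1 + fps_nth ?A (n - i))"
    by (rule sum.mono_neutral_cong_right) auto
  also have "\<dots> = fps_nth ?A n"
    unfolding height_gf_nth card_level_2[of n] by simp
  finally show "fps_nth ?A n = fps_nth (fps_X ^ 2 * ?G * (?G + ?A)) n" ..
qed

lemma height_gf_2:
  "height_gf [U, U, D] 2 = fps_X ^ 2 / ((fps_X - 1) * (fps_X ^ 2 + fps_X - 1))"
proof -
  let ?Q = "(fps_X - 1) * (fps_X ^ 2 + fps_X - 1) :: rat fps"
  \<comment> \<open>The functional equation is linear in the unknown series. Multiplying by
    \<open>(1 - fps_X) ^ 2\<close> clears the geometric series.\<close>
  have "height_gf [U, U, D] 2 * ?Q = fps_X ^ 2"
    using height_gf_2_functional_equation geometric_fps by algebra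
  moreover have "?Q \<noteq> 0"
  proof
    assume "?Q = 0"
    \<comment> \<open>The constant term of \<open>?Q\<close> is in fact (-1)(-1) = 1.\<close>
    then have "fps_nth ?Q 0 = 0" by simp
    then show False by simp
  qed
  ultimately show ?thesis
    by (metis nonzero_mult_div_cancel_right)
qed

theorem theorem2:
  fixes \<pi> :: "step list" and A :: "nat \<Rightarrow> rat fps"
  assumes "\<pi> = [U, U, D]"
    and "\<And>k. A k = height_gf \<pi> k"
  shows "amplitude \<pi> = 2
    \<and> A 2 = fps_X ^ 2 / ((fps_X - 1) * (fps_X ^ 2 + fps_X - 1))
    \<and> A 1 = 0
    \<and> A 0 = 1 / (1 - fps_X)"
  using assms height_gf_0 height_gf_1 height_gf_2 by (simp add: amplitude_def)

end
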